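(* Let $(M,\circ,e)$ be an $F$-manifold, $\mathcal{E}$ an eventual identity on $(M,\circ,e)$, and $\tilde{\nabla}$ a torsion-free connection on $TM$ which is compatible with $\circ$. Let $A$ be a section of $\mathrm{End}(TM)$ and let $\nabla^{A}$ be the connection on $TM$ defined by $$\nabla^{A}_{X}Y=\mathcal{E}\circ\tilde{\nabla}_{X}(\mathcal{E}^{-1}\circ Y)+A(Y)\circ X,\qquad\forall X,Y\in\mathcal{X}(M).$$ Then $\nabla^{A}$ is torsion-free and compatible with the dual multiplication $X*Y:=X\circ Y\circ\mathcal{E}^{-1}$ if and only if $$A(Y)=\mathcal{E}\circ\tilde{\nabla}_{Y}(\mathcal{E}^{-1})+V\circ Y,\qquad\forall Y\in\mathcal{X}(M),$$ where $V$ is an arbitrary vector field (i.e. if and only if $A$ is of this form for some $V\in\mathcal{X}(M)$).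
   Context: Everything is in the smooth category; $\mathcal{X}(M)$ denotes the vector fields on the manifold $M$. $F$-manifold: a triple $(M,\circ,e)$ where $M$ is a manifold and $\circ$ is a fiber-preserving commutative, associative, bilinear multiplication on $TM$ with unit field $e$, such that $L_{X\circ Y}(\circ)=X\circ L_{Y}(\circ)+Y\circ L_{X}(\circ)$ for all $X,Y\in\mathcal{X}(M)$, where $L_{Z}(\circ)(X,Y)=[Z,X\circ Y]-[Z,X]\circ Y-X\circ[Z,Y]$. Invertible vector field: $\mathcal{E}$ is invertible if there is a vector field $\mathcal{E}^{-1}$ with $\mathcal{E}\circ\mathcal{E}^{-1}=e$. Eventual identity on an $F$-manifold $(M,\circ,e)$: an invertible vector field $\mathcal{E}$ such that the multiplication $X*Y:=X\circ Y\circ\mathcal{E}^{-1}$ (whose unit field is $\mathcal{E}$) defines an $F$-manifold $(M,*,\mathcal{E})$, called the dual $F$-manifold; $*$ is called the dual multiplication. Compatible connection: a connection $\nabla$ on $TM$ is compatible with a commutative, associative multiplication $\circ$ on $TM$ if $\nabla_{X}(\circ)(Y,Z):=\nabla_{X}(Y\circ Z)-\nabla_{X}(Y)\circ Z-Y\circ\nabla_{X}(Z)$ is totally symmetric in $X,Y,Z$ (the same definition is used with $*$ in place of $\circ$). *)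

theory Defs
  imports "HOL-Analysis.Analysis" "HOL-Library.Function_Algebras"
begin

text \<open>
  Smooth manifolds are not available in the imported sessions, so they are developed here from
  atlases. Points of \<open>\<real>\<^sup>n\<close> are the points of the library's \<open>Euclidean_space n\<close>, i.e. functions on
  the naturals that vanish from \<open>n\<close> on; the dimension is thus an ordinary natural number and may
  be \<open>0\<close>.
\<close>

section \<open>Smooth functions and smooth manifolds\<close>

text \<open>\<open>Ck_on n k S f\<close>: on the open set \<open>S\<close> of \<open>\<real>\<^sup>n\<close>, all partial derivatives of \<open>f\<close> of order
  at most \<open>k\<close> exist and are continuous. \<open>D i\<close> is the \<open>i\<close>-th partial derivative.\<close>

primrec Ck_on :: "nat \<Rightarrow> nat \<Rightarrow> (nat \<Rightarrow> real) set \<Rightarrow> ((nat \<Rightarrow> real) \<Rightarrow> real) \<Rightarrow> bool" where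
  "Ck_on n 0 S f \<longleftrightarrow> continuous_map (subtopology (Euclidean_space n) S) euclideanreal f"
| "Ck_on n (Suc k) S f \<longleftrightarrow>
     continuous_map (subtopology (Euclidean_space n) S) euclideanreal f \<and>
     (\<exists>D. \<forall>i<n. (\<forall>x\<in>S. ((\<lambda>t. f (x(i := t))) has_real_derivative D i x) (at (x i))) \<and>
                Ck_on n k S (D i))"

definition Cinf_on :: "nat \<Rightarrow> (nat \<Rightarrow> real) set \<Rightarrow> ((nat \<Rightarrow> real) \<Rightarrow> real) \<Rightarrow> bool" where
  "Cinf_on n S f \<longleftrightarrow> (\<forall>k. Ck_on n k S f)"

record 'a manifold =
  mf_dim :: nat
  mf_top :: "'a topology"
  mf_atlas :: "('a set \<times> ('a \<Rightarrow> nat \<Rightarrow> real)) set"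

definition points :: "'a manifold \<Rightarrow> 'a set" where
  "points M = topspace (mf_top M)"

definition is_chart :: "'a manifold \<Rightarrow> 'a set \<Rightarrow> ('a \<Rightarrow> nat \<Rightarrow> real) \<Rightarrow> bool" where
  "is_chart M U \<phi> \<longleftrightarrow>
     openin (mf_top M) U \<and> openin (Euclidean_space (mf_dim M)) (\<phi> ` U) \<and>
     homeomorphic_map (subtopology (mf_top M) U)
       (subtopology (Euclidean_space (mf_dim M)) (\<phi> ` U)) \<phi>"

definition smooth_manifold :: "'a manifold \<Rightarrow> bool" where
  "smooth_manifold M \<longleftrightarrow>
     Hausdorff_space (mf_top M) \<and> second_countable (mf_top M) \<and>
     (\<forall>(U, \<phi>)\<in>mf_atlas M. is_chart M U \<phi>) \<and>
     (\<Union>(U, \<phi>)\<in>mf_atlas M. U) = points M \<and>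
     (\<forall>(U, \<phi>)\<in>mf_atlas M. \<forall>(V, \<psi>)\<in>mf_atlas M. \<forall>i<mf_dim M.
        Cinf_on (mf_dim M) (\<phi> ` (U \<inter> V)) (\<lambda>x. \<psi> (inv_into U \<phi> x) i))"

text \<open>Smooth functions, tangent vectors and vector fields are normalised to be \<open>0\<close> where they
  carry no information, so that their equality is equality of functions and their sums are the
  pointwise ones.\<close>

definition smooth_functions :: "'a manifold \<Rightarrow> ('a \<Rightarrow> real) set" where
  "smooth_functions M =
     {f. (\<forall>(U, \<phi>)\<in>mf_atlas M. Cinf_on (mf_dim M) (\<phi> ` U) (\<lambda>x. f (inv_into U \<phi> x))) \<and>
         (\<forall>p. p \<notin> points M \<longrightarrow> f p = 0)}"


section \<open>Tangent vectors and vector fields\<close>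

type_synonym 'a tangent = "('a \<Rightarrow> real) \<Rightarrow> real"
type_synonym 'a vfield = "'a \<Rightarrow> 'a tangent"

text \<open>Tangent vectors at \<open>p\<close> are the derivations at \<open>p\<close> of the algebra of smooth functions.\<close>

definition tangent_space :: "'a manifold \<Rightarrow> 'a \<Rightarrow> 'a tangent set" where
  "tangent_space M p =
     {v. (\<forall>f\<in>smooth_functions M. \<forall>g\<in>smooth_functions M. v (f + g) = v f + v g) \<and>
         (\<forall>c. \<forall>f\<in>smooth_functions M. v (\<lambda>x. c * f x) = c * v f) \<and>
         (\<forall>f\<in>smooth_functions M. \<forall>g\<in>smooth_functions M. v (f * g) = f p * v g + g p * v f) \<and>
         (\<forall>f. f \<notin> smooth_functions M \<longrightarrow> v f = 0)}"

definition vector_fields :: "'a manifold \<Rightarrow> 'a vfield set" where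
  "vector_fields M =
     {X. (\<forall>p\<in>points M. X p \<in> tangent_space M p) \<and> (\<forall>p. p \<notin> points M \<longrightarrow> X p = 0) \<and>
         (\<forall>f\<in>smooth_functions M. (\<lambda>p. X p f) \<in> smooth_functions M)}"

definition fscale :: "('a \<Rightarrow> real) \<Rightarrow> 'a vfield \<Rightarrow> 'a vfield" where
  "fscale f X = (\<lambda>p g. f p * X p g)"

definition lie_bracket :: "'a vfield \<Rightarrow> 'a vfield \<Rightarrow> 'a vfield" where
  "lie_bracket X Y = (\<lambda>p f. X p (\<lambda>q. Y q f) - Y p (\<lambda>q. X q f))"


section \<open>Sections of \<open>End(TM)\<close> and multiplications on \<open>TM\<close>\<close>

definition linear_on_tangent ::
  "'a manifold \<Rightarrow> 'a \<Rightarrow> ('a tangent \<Rightarrow> 'a tangent) \<Rightarrow> bool" where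
  "linear_on_tangent M p L \<longleftrightarrow>
     (\<forall>v\<in>tangent_space M p. L v \<in> tangent_space M p) \<and>
     (\<forall>v\<in>tangent_space M p. \<forall>w\<in>tangent_space M p. L (v + w) = L v + L w) \<and>
     (\<forall>c. \<forall>v\<in>tangent_space M p. L (\<lambda>f. c * v f) = (\<lambda>f. c * L v f))"

type_synonym 'a endo = "'a \<Rightarrow> 'a tangent \<Rightarrow> 'a tangent"

definition app_endo :: "'a manifold \<Rightarrow> 'a endo \<Rightarrow> 'a vfield \<Rightarrow> 'a vfield" where
  "app_endo M A X = (\<lambda>p. if p \<in> points M then A p (X p) else 0)"

text \<open>A family of fibrewise linear maps is smooth iff it maps smooth fields to smooth fields; the
  same criterion is used for multiplications.\<close>

definition endo_section :: "'a manifold \<Rightarrow> 'a endo \<Rightarrow> bool" where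
  "endo_section M A \<longleftrightarrow>
     (\<forall>p\<in>points M. linear_on_tangent M p (A p)) \<and>
     (\<forall>X\<in>vector_fields M. app_endo M A X \<in> vector_fields M)"

type_synonym 'a tmult = "'a \<Rightarrow> 'a tangent \<Rightarrow> 'a tangent \<Rightarrow> 'a tangent"

definition vmult :: "'a manifold \<Rightarrow> 'a tmult \<Rightarrow> 'a vfield \<Rightarrow> 'a vfield \<Rightarrow> 'a vfield" where
  "vmult M m X Y = (\<lambda>p. if p \<in> points M then m p (X p) (Y p) else 0)"

definition tangent_multiplication :: "'a manifold \<Rightarrow> 'a tmult \<Rightarrow> bool" where
  "tangent_multiplication M m \<longleftrightarrow>
     (\<forall>p\<in>points M.
        (\<forall>v\<in>tangent_space M p. linear_on_tangent M p (m p v)) \<and>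
        (\<forall>v\<in>tangent_space M p. linear_on_tangent M p (\<lambda>u. m p u v)) \<and>
        (\<forall>u\<in>tangent_space M p. \<forall>v\<in>tangent_space M p. m p u v = m p v u) \<and>
        (\<forall>u\<in>tangent_space M p. \<forall>v\<in>tangent_space M p. \<forall>w\<in>tangent_space M p.
           m p (m p u v) w = m p u (m p v w))) \<and>
     (\<forall>X\<in>vector_fields M. \<forall>Y\<in>vector_fields M. vmult M m X Y \<in> vector_fields M)"

definition unit_field :: "'a manifold \<Rightarrow> 'a tmult \<Rightarrow> 'a vfield \<Rightarrow> bool" where
  "unit_field M m e \<longleftrightarrow>
     e \<in> vector_fields M \<and> (\<forall>p\<in>points M. \<forall>v\<in>tangent_space M p. m p (e p) v = v)"


section \<open>F-manifolds and eventual identities\<close>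

definition lie_mult ::
  "'a manifold \<Rightarrow> 'a tmult \<Rightarrow> 'a vfield \<Rightarrow> 'a vfield \<Rightarrow> 'a vfield \<Rightarrow> 'a vfield" where
  "lie_mult M m Z X Y =
     lie_bracket Z (vmult M m X Y) - vmult M m (lie_bracket Z X) Y - vmult M m X (lie_bracket Z Y)"

definition F_manifold :: "'a manifold \<Rightarrow> 'a tmult \<Rightarrow> 'a vfield \<Rightarrow> bool" where
  "F_manifold M m e \<longleftrightarrow>
     smooth_manifold M \<and> tangent_multiplication M m \<and> unit_field M m e \<and>
     (\<forall>X\<in>vector_fields M. \<forall>Y\<in>vector_fields M. \<forall>Z\<in>vector_fields M. \<forall>W\<in>vector_fields M.
        lie_mult M m (vmult M m X Y) Z W =
        vmult M m X (lie_mult M m Y Z W) + vmult M m Y (lie_mult M m X Z W))"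

definition invertible_field :: "'a manifold \<Rightarrow> 'a tmult \<Rightarrow> 'a vfield \<Rightarrow> 'a vfield \<Rightarrow> bool" where
  "invertible_field M m e E \<longleftrightarrow>
     E \<in> vector_fields M \<and> (\<exists>Z\<in>vector_fields M. vmult M m E Z = e)"

text \<open>The inverse is unique by associativity and commutativity of the multiplication.\<close>

definition inverse_field :: "'a manifold \<Rightarrow> 'a tmult \<Rightarrow> 'a vfield \<Rightarrow> 'a vfield \<Rightarrow> 'a vfield" where
  "inverse_field M m e E = (THE Z. Z \<in> vector_fields M \<and> vmult M m E Z = e)"

definition dual_mult :: "'a manifold \<Rightarrow> 'a tmult \<Rightarrow> 'a vfield \<Rightarrow> 'a vfield \<Rightarrow> 'a tmult" where
  "dual_mult M m e E = (\<lambda>p v w. m p (m p v w) (inverse_field M m e E p))"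

definition eventual_identity :: "'a manifold \<Rightarrow> 'a tmult \<Rightarrow> 'a vfield \<Rightarrow> 'a vfield \<Rightarrow> bool" where
  "eventual_identity M m e E \<longleftrightarrow>
     invertible_field M m e E \<and> F_manifold M (dual_mult M m e E) E"


section \<open>Connections on \<open>TM\<close>\<close>

type_synonym 'a cov_deriv = "'a vfield \<Rightarrow> 'a vfield \<Rightarrow> 'a vfield"

definition connection :: "'a manifold \<Rightarrow> 'a cov_deriv \<Rightarrow> bool" where
  "connection M D \<longleftrightarrow>
     (\<forall>X\<in>vector_fields M. \<forall>Y\<in>vector_fields M. D X Y \<in> vector_fields M) \<and>
     (\<forall>X\<in>vector_fields M. \<forall>X'\<in>vector_fields M. \<forall>Y\<in>vector_fields M.
        D (X + X') Y = D X Y + D X' Y) \<and>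
     (\<forall>X\<in>vector_fields M. \<forall>Y\<in>vector_fields M. \<forall>Y'\<in>vector_fields M.
        D X (Y + Y') = D X Y + D X Y') \<and>
     (\<forall>f\<in>smooth_functions M. \<forall>X\<in>vector_fields M. \<forall>Y\<in>vector_fields M.
        D (fscale f X) Y = fscale f (D X Y)) \<and>
     (\<forall>f\<in>smooth_functions M. \<forall>X\<in>vector_fields M. \<forall>Y\<in>vector_fields M.
        D X (fscale f Y) = fscale (\<lambda>p. X p f) Y + fscale f (D X Y))"

definition torsion_free :: "'a manifold \<Rightarrow> 'a cov_deriv \<Rightarrow> bool" where
  "torsion_free M D \<longleftrightarrow>
     (\<forall>X\<in>vector_fields M. \<forall>Y\<in>vector_fields M. D X Y - D Y X = lie_bracket X Y)"

definition nabla_mult ::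
  "'a manifold \<Rightarrow> 'a tmult \<Rightarrow> 'a cov_deriv \<Rightarrow> 'a vfield \<Rightarrow> 'a vfield \<Rightarrow> 'a vfield \<Rightarrow> 'a vfield" where
  "nabla_mult M m D X Y Z =
     D X (vmult M m Y Z) - vmult M m (D X Y) Z - vmult M m Y (D X Z)"

text \<open>Total symmetry is invariance under the two adjacent transpositions, which generate all
  permutations of the three arguments.\<close>

definition compatible :: "'a manifold \<Rightarrow> 'a tmult \<Rightarrow> 'a cov_deriv \<Rightarrow> bool" where
  "compatible M m D \<longleftrightarrow>
     (\<forall>X\<in>vector_fields M. \<forall>Y\<in>vector_fields M. \<forall>Z\<in>vector_fields M.
        nabla_mult M m D X Y Z = nabla_mult M m D Y X Z \<and>
        nabla_mult M m D X Y Z = nabla_mult M m D X Z Y)"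

definition nabla_A ::
  "'a manifold \<Rightarrow> 'a tmult \<Rightarrow> 'a vfield \<Rightarrow> 'a vfield \<Rightarrow> 'a cov_deriv \<Rightarrow> 'a endo \<Rightarrow> 'a cov_deriv" where
  "nabla_A M m e E D A X Y =
     vmult M m E (D X (vmult M m (inverse_field M m e E) Y)) + vmult M m (app_endo M A Y) X"

end

theory Submission
  imports Defs
begin

text \<open>
  Write \<open>Z\<close> for the inverse of \<open>E\<close> and \<open>B(Y) = A(Y) - E \<circ> D\<^sub>Y Z\<close>. As \<open>D\<close> is torsion-free and
  compatible with \<open>\<circ>\<close>, the torsion of the new connection is \<open>B(Y) \<circ> X - B(X) \<circ> Y\<close>; putting \<open>X = e\<close>,
  it vanishes iff \<open>B\<close> is multiplication by \<open>B(e)\<close>. So torsion-freeness alone forces the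
  shape of \<open>A\<close>.

  It remains to see that this shape implies compatibility with \<open>*\<close>. As \<open>E\<close> is the unit of the dual
  \<open>F\<close>-manifold, \<open>L\<^sub>E(*) = 0\<close>, which forces \<open>L\<^sub>E(\<circ>)(X, Y) = k \<circ> X \<circ> Y\<close> for a field \<open>k\<close>; since
  \<open>0 = L\<^sub>e(\<circ>) = E \<circ> L\<^sub>Z(\<circ>) + Z \<circ> L\<^sub>E(\<circ>)\<close>, also \<open>L\<^sub>Z(\<circ>)\<close> has this form. Using it to rewrite the
  terms \<open>D\<^sub>P Z\<close> with \<open>P\<close> a product, the asymmetry reduces to the Hochschild cocycle identity for
  \<open>D\<^sub>W(\<circ>)\<close>.
\<close>

section \<open>Commutative algebras of vector fields\<close>

locale comm_mult =
  fixes C :: "'v::ab_group_add set"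
    and mul :: "'v \<Rightarrow> 'v \<Rightarrow> 'v" (infixl "\<cdot>" 70)
    and e :: 'v
  assumes diff_closed [simp]: "x \<in> C \<Longrightarrow> y \<in> C \<Longrightarrow> x - y \<in> C"
    and mul_closed [simp]: "x \<in> C \<Longrightarrow> y \<in> C \<Longrightarrow> x \<cdot> y \<in> C"
    and mul_comm: "x \<in> C \<Longrightarrow> y \<in> C \<Longrightarrow> x \<cdot> y = y \<cdot> x"
    and mul_assoc: "x \<in> C \<Longrightarrow> y \<in> C \<Longrightarrow> z \<in> C \<Longrightarrow> x \<cdot> y \<cdot> z = x \<cdot> (y \<cdot> z)"
    and distrib_right: "x \<in> C \<Longrightarrow> y \<in> C \<Longrightarrow> z \<in> C \<Longrightarrow> (x + y) \<cdot> z = x \<cdot> z + y \<cdot> z"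
    and unit_closed [simp]: "e \<in> C"
    and unit_mul [simp]: "x \<in> C \<Longrightarrow> e \<cdot> x = x"
begin

lemma zero_closed [simp]: "0 \<in> C"
  using diff_closed[OF unit_closed unit_closed] by simp

lemma minus_closed [simp]: "x \<in> C \<Longrightarrow> - x \<in> C"
  using diff_closed[OF zero_closed] by fastforce

lemma add_closed [simp]: "x \<in> C \<Longrightarrow> y \<in> C \<Longrightarrow> x + y \<in> C"
  using diff_closed[OF _ minus_closed, of x y] by simp

lemma mul_left_comm: "x \<in> C \<Longrightarrow> y \<in> C \<Longrightarrow> z \<in> C \<Longrightarrow> x \<cdot> (y \<cdot> z) = y \<cdot> (x \<cdot> z)"
  by (metis mul_assoc mul_comm)

lemmas mul_ac = mul_assoc mul_comm mul_left_comm

lemma distrib_left: "x \<in> C \<Longrightarrow> y \<in> C \<Longrightarrow> z \<in> C \<Longrightarrow> z \<cdot> (x + y) = z \<cdot> x + z \<cdot> y"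
  by (simp add: mul_comm[of z] distrib_right)

lemma diff_distrib_right: "x \<in> C \<Longrightarrow> y \<in> C \<Longrightarrow> z \<in> C \<Longrightarrow> (x - y) \<cdot> z = x \<cdot> z - y \<cdot> z"
  using distrib_right[of "x - y" y z] by (simp add: algebra_simps)

lemma diff_distrib_left: "x \<in> C \<Longrightarrow> y \<in> C \<Longrightarrow> z \<in> C \<Longrightarrow> z \<cdot> (x - y) = z \<cdot> x - z \<cdot> y"
  by (simp add: mul_comm[of z] diff_distrib_right)

lemma zero_mul [simp]: "x \<in> C \<Longrightarrow> 0 \<cdot> x = 0"
  using diff_distrib_right[of x x x] by simp

lemma mul_zero [simp]: "x \<in> C \<Longrightarrow> x \<cdot> 0 = 0"
  using diff_distrib_left[of x x x] by simp

lemmas mul_simps = mul_ac distrib_left distrib_right diff_distrib_left diff_distrib_right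

lemma mul_unit [simp]: "x \<in> C \<Longrightarrow> x \<cdot> e = x"
  by (simp add: mul_comm[of x])

definition leibniz_defect :: "('v \<Rightarrow> 'v) \<Rightarrow> 'v \<Rightarrow> 'v \<Rightarrow> 'v" where
  "leibniz_defect d x y = d (x \<cdot> y) - d x \<cdot> y - x \<cdot> d y"

lemma leibniz_defect_closed [simp]:
  "(\<And>x. x \<in> C \<Longrightarrow> d x \<in> C) \<Longrightarrow> x \<in> C \<Longrightarrow> y \<in> C \<Longrightarrow> leibniz_defect d x y \<in> C"
  by (simp add: leibniz_defect_def)

lemma leibniz_defect_comm:
  "(\<And>x. x \<in> C \<Longrightarrow> d x \<in> C) \<Longrightarrow> x \<in> C \<Longrightarrow> y \<in> C \<Longrightarrow>
    leibniz_defect d x y = leibniz_defect d y x"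
  by (simp add: leibniz_defect_def mul_comm)

lemma leibniz_expand: "d (x \<cdot> y) = leibniz_defect d x y + d x \<cdot> y + x \<cdot> d y"
  by (simp add: leibniz_defect_def)

lemma leibniz_defect_cocycle:
  assumes "\<And>x. x \<in> C \<Longrightarrow> d x \<in> C" and "x \<in> C" "y \<in> C" "z \<in> C"
  shows "leibniz_defect d (x \<cdot> y) z + leibniz_defect d x y \<cdot> z =
         leibniz_defect d x (y \<cdot> z) + x \<cdot> leibniz_defect d y z"
  using assms by (simp add: leibniz_defect_def mul_simps algebra_simps)

end


section \<open>Torsion-free compatible connections, algebraically\<close>

locale comm_mult_inverse = comm_mult +
  fixes E Z
  assumes E_closed [simp]: "E \<in> C" and Z_closed [simp]: "Z \<in> C"
    and E_Z [simp]: "E \<cdot> Z = e"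
begin

lemma Z_E [simp]: "Z \<cdot> E = e"
  using mul_comm[of Z E] by simp

lemma E_Z_mul [simp]: "x \<in> C \<Longrightarrow> E \<cdot> (Z \<cdot> x) = x"
  by (simp flip: mul_assoc)

lemma Z_E_mul [simp]: "x \<in> C \<Longrightarrow> Z \<cdot> (E \<cdot> x) = x"
  by (simp flip: mul_assoc)

lemma dual_derivation_defect:
  assumes d: "\<And>x. x \<in> C \<Longrightarrow> d x \<in> C"
    and deriv: "\<And>x y. x \<in> C \<Longrightarrow> y \<in> C \<Longrightarrow> d (x \<cdot> y \<cdot> Z) = d x \<cdot> y \<cdot> Z + x \<cdot> d y \<cdot> Z"
  shows "\<exists>k\<in>C. \<forall>x\<in>C. \<forall>y\<in>C. leibniz_defect d x y = k \<cdot> (x \<cdot> y)"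
proof -
  let ?L = "leibniz_defect d"
  note [simp] = d
  have [simp]: "d E = 0"
    using deriv[of E E] by (simp add: mul_assoc mul_comm[of "d E" Z])
  have step: "?L (E \<cdot> s) t = s \<cdot> ?L E t" if st [simp]: "s \<in> C" "t \<in> C" for s t
  proof -
    have "d (E \<cdot> (s \<cdot> t)) = d (E \<cdot> s \<cdot> (E \<cdot> t) \<cdot> Z)"
      by (simp add: mul_assoc mul_comm[of t] mul_left_comm[of t] mul_left_comm[of s Z])
    also have "\<dots> = d (E \<cdot> s) \<cdot> t + s \<cdot> d (E \<cdot> t)"
    proof -
      have "d (E \<cdot> s) \<cdot> (E \<cdot> t) \<cdot> Z = d (E \<cdot> s) \<cdot> t"
        using mul_comm[of t Z] by (simp add: mul_assoc mul_left_comm[of _ Z])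
      moreover have "E \<cdot> s \<cdot> d (E \<cdot> t) \<cdot> Z = s \<cdot> d (E \<cdot> t)"
        using mul_comm[of "s \<cdot> d (E \<cdot> t)" Z] by (simp add: mul_assoc mul_left_comm[of _ Z])
      ultimately show ?thesis by (simp add: deriv)
    qed
    finally have "?L E (s \<cdot> t) + E \<cdot> ?L s t = ?L E s \<cdot> t + s \<cdot> ?L E t"
      by (simp add: leibniz_defect_def mul_simps algebra_simps)
    then show ?thesis
      using leibniz_defect_cocycle[of d E s t] by (simp add: algebra_simps)
  qed
  have step': "?L x t = (Z \<cdot> x) \<cdot> ?L E t" if "x \<in> C" "t \<in> C" for x t
    using step[of "Z \<cdot> x" t] that by simp
  have "?L x y = Z \<cdot> Z \<cdot> ?L E E \<cdot> (x \<cdot> y)" if [simp]: "x \<in> C" "y \<in> C" for x y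
  proof -
    have "?L x y = (Z \<cdot> x) \<cdot> ((Z \<cdot> y) \<cdot> ?L E E)"
      using step'[of x y] step'[of y E] leibniz_defect_comm[of d E y] by simp
    then show ?thesis by (simp add: mul_ac)
  qed
  moreover have "Z \<cdot> Z \<cdot> ?L E E \<in> C" by simp
  ultimately show ?thesis by blast
qed

end

locale compatible_connection = comm_mult_inverse +
  fixes D :: "'a \<Rightarrow> 'a \<Rightarrow> 'a"
  assumes D_closed [simp]: "x \<in> C \<Longrightarrow> y \<in> C \<Longrightarrow> D x y \<in> C"
    and defect_D_swap: "x \<in> C \<Longrightarrow> y \<in> C \<Longrightarrow> z \<in> C \<Longrightarrow>
      leibniz_defect (D x) y z = leibniz_defect (D y) x z"
begin

definition bracket :: "'a \<Rightarrow> 'a \<Rightarrow> 'a" where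
  "bracket x y = D x y - D y x"

lemma bracket_closed [simp]: "x \<in> C \<Longrightarrow> y \<in> C \<Longrightarrow> bracket x y \<in> C"
  by (simp add: bracket_def)

abbreviation lie_defect :: "'a \<Rightarrow> 'a \<Rightarrow> 'a \<Rightarrow> 'a" where
  "lie_defect x \<equiv> leibniz_defect (bracket x)"

definition nabla :: "('a \<Rightarrow> 'a) \<Rightarrow> 'a \<Rightarrow> 'a \<Rightarrow> 'a" where
  "nabla a x y = E \<cdot> D x (Z \<cdot> y) + a y \<cdot> x"

lemma nabla_torsion:
  assumes a: "\<And>x. x \<in> C \<Longrightarrow> a x \<in> C" and xy [simp]: "x \<in> C" "y \<in> C"
  shows "nabla a x y - nabla a y x - bracket x y =
         (a y - E \<cdot> D y Z) \<cdot> x - (a x - E \<cdot> D x Z) \<cdot> y"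
proof -
  note [simp] = a
  have exp: "E \<cdot> D u (Z \<cdot> v) = E \<cdot> leibniz_defect (D u) Z v + E \<cdot> D u Z \<cdot> v + D u v"
    if [simp]: "u \<in> C" "v \<in> C" for u v
    by (simp add: leibniz_expand[of "D u"] distrib_left mul_assoc)
  have "leibniz_defect (D x) Z y = leibniz_defect (D y) Z x"
    using defect_D_swap[of x y Z]
    by (simp add: leibniz_defect_comm[of "D x" Z y] leibniz_defect_comm[of "D y" Z x])
  then show ?thesis
    by (simp add: nabla_def exp bracket_def diff_distrib_right)
qed

lemma nabla_torsion_free_iff:
  assumes a: "\<And>x. x \<in> C \<Longrightarrow> a x \<in> C"
  shows "(\<forall>x\<in>C. \<forall>y\<in>C. nabla a x y - nabla a y x = bracket x y) \<longleftrightarrow>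
         (\<exists>v\<in>C. \<forall>y\<in>C. a y = E \<cdot> D y Z + v \<cdot> y)"
    (is "?T \<longleftrightarrow> ?F")
proof -
  define b where "b = (\<lambda>y. a y - E \<cdot> D y Z)"
  have b_closed [simp]: "b y \<in> C" if "y \<in> C" for y
    using that a by (simp add: b_def)
  have "nabla a x y - nabla a y x = bracket x y \<longleftrightarrow> b y \<cdot> x = b x \<cdot> y"
    if "x \<in> C" "y \<in> C" for x y
  proof -
    have "nabla a x y - nabla a y x - bracket x y = b y \<cdot> x - b x \<cdot> y"
      using nabla_torsion[of a x y] a that by (simp add: b_def)
    then show ?thesis by (metis right_minus_eq)
  qed
  then have "?T \<longleftrightarrow> (\<forall>x\<in>C. \<forall>y\<in>C. b y \<cdot> x = b x \<cdot> y)"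
    by simp
  also have "\<dots> \<longleftrightarrow> (\<exists>v\<in>C. \<forall>y\<in>C. b y = v \<cdot> y)"
  proof
    assume "\<forall>x\<in>C. \<forall>y\<in>C. b y \<cdot> x = b x \<cdot> y"
    then have "\<forall>y\<in>C. b y = b e \<cdot> y"
      by (metis b_closed mul_unit unit_closed)
    then show "\<exists>v\<in>C. \<forall>y\<in>C. b y = v \<cdot> y"
      using b_closed unit_closed by blast
  next
    assume "\<exists>v\<in>C. \<forall>y\<in>C. b y = v \<cdot> y"
    then show "\<forall>x\<in>C. \<forall>y\<in>C. b y \<cdot> x = b x \<cdot> y"
      by (auto simp: mul_ac)
  qed
  also have "\<dots> \<longleftrightarrow> ?F"
    by (simp add: b_def algebra_simps)
  finally show ?thesis .
qed

lemma inverse_lie_defect: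
  assumes lie_E: "\<forall>x\<in>C. \<forall>y\<in>C. lie_defect E x y = k \<cdot> (x \<cdot> y)" and k [simp]: "k \<in> C"
    and lie_mul: "\<And>x y z w. x \<in> C \<Longrightarrow> y \<in> C \<Longrightarrow> z \<in> C \<Longrightarrow> w \<in> C \<Longrightarrow>
      lie_defect (x \<cdot> y) z w = x \<cdot> lie_defect y z w + y \<cdot> lie_defect x z w"
    and xy [simp]: "x \<in> C" "y \<in> C"
  shows "lie_defect Z x y = - (Z \<cdot> Z \<cdot> k) \<cdot> (x \<cdot> y)"
proof -
  have "lie_defect e x y = 0"
    using lie_mul[of e e x y] by simp
  then have "E \<cdot> lie_defect Z x y + Z \<cdot> lie_defect E x y = 0"
    using lie_mul[of E Z x y] by simp
  moreover have "lie_defect Z x y + Z \<cdot> (Z \<cdot> lie_defect E x y) =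
      Z \<cdot> (E \<cdot> lie_defect Z x y + Z \<cdot> lie_defect E x y)"
    by (simp add: distrib_left)
  ultimately have "lie_defect Z x y = 0 - Z \<cdot> (Z \<cdot> (k \<cdot> (x \<cdot> y)))"
    using lie_E by (simp add: eq_neg_iff_add_eq_0)
  moreover have "- (Z \<cdot> Z \<cdot> k) \<cdot> (x \<cdot> y) = 0 - Z \<cdot> Z \<cdot> k \<cdot> (x \<cdot> y)"
    using diff_distrib_right[of 0 "Z \<cdot> Z \<cdot> k" "x \<cdot> y"] by simp
  ultimately show ?thesis by (simp add: mul_assoc)
qed

lemma derivative_of_Z_along_product:
  assumes lie_Z: "\<forall>x\<in>C. \<forall>y\<in>C. lie_defect Z x y = k \<cdot> (x \<cdot> y)" and [simp]: "k \<in> C"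
    and [simp]: "y \<in> C" "w \<in> C"
  shows "D (y \<cdot> w) Z =
    leibniz_defect (D w) y Z + D y Z \<cdot> w + y \<cdot> (D Z w - bracket Z w - k \<cdot> w)"
proof -
  have "D (y \<cdot> w) Z = D Z (y \<cdot> w) - bracket Z (y \<cdot> w)"
    by (simp add: bracket_def)
  also have "D Z (y \<cdot> w) = leibniz_defect (D w) y Z + D Z y \<cdot> w + y \<cdot> D Z w"
    using defect_D_swap[of Z w y]
    by (simp add: leibniz_expand[of "D Z"] leibniz_defect_comm[of "D Z" y w]
        leibniz_defect_comm[of "D w" y Z])
  also have "bracket Z (y \<cdot> w) = y \<cdot> (k \<cdot> w) + (D Z y - D y Z) \<cdot> w + y \<cdot> bracket Z w"
    using lie_Z by (simp add: leibniz_expand[of "bracket Z"] bracket_def[of Z y] mul_left_comm[of k])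
  finally show ?thesis
    by (simp add: distrib_left diff_distrib_left diff_distrib_right algebra_simps)
qed

lemma compatibility_core_sym:
  assumes lie_Z: "\<forall>x\<in>C. \<forall>y\<in>C. lie_defect Z x y = k \<cdot> (x \<cdot> y)" and [simp]: "k \<in> C"
    and [simp]: "x \<in> C" "y \<in> C" "w \<in> C"
  shows "leibniz_defect (D x) (Z \<cdot> y) w + D (y \<cdot> w) Z \<cdot> x - D y Z \<cdot> x \<cdot> w =
         leibniz_defect (D y) (Z \<cdot> x) w + D (x \<cdot> w) Z \<cdot> y - D x Z \<cdot> y \<cdot> w"
proof -
  define c where "c = D Z w - bracket Z w - k \<cdot> w"
  have [simp]: "c \<in> C" by (simp add: c_def)
  let ?N = "leibniz_defect (D w)"
  have *: "leibniz_defect (D u) (Z \<cdot> v) w + D (v \<cdot> w) Z \<cdot> u - D v Z \<cdot> u \<cdot> w =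
      (?N (v \<cdot> Z) u + ?N v Z \<cdot> u) + u \<cdot> v \<cdot> c" if [simp]: "u \<in> C" "v \<in> C" for u v
  proof -
    have "leibniz_defect (D u) (Z \<cdot> v) w = ?N (v \<cdot> Z) u"
      using defect_D_swap[of u w "v \<cdot> Z"]
      by (simp add: mul_comm[of Z v] leibniz_defect_comm[of "D u" "v \<cdot> Z" w]
          leibniz_defect_comm[of "D w" "v \<cdot> Z" u])
    moreover have "D (v \<cdot> w) Z = ?N v Z + D v Z \<cdot> w + v \<cdot> c"
      unfolding c_def by (rule derivative_of_Z_along_product[OF lie_Z]) simp_all
    then have "D (v \<cdot> w) Z \<cdot> u = ?N v Z \<cdot> u + D v Z \<cdot> u \<cdot> w + u \<cdot> v \<cdot> c"
      by (simp add: distrib_left distrib_right mul_ac)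
    ultimately show ?thesis by simp
  qed
  have "?N (y \<cdot> Z) x + ?N y Z \<cdot> x = ?N (x \<cdot> Z) y + ?N x Z \<cdot> y"
    using leibniz_defect_cocycle[of "D w" y Z x]
    by (simp add: leibniz_defect_comm[of "D w" y "x \<cdot> Z"] leibniz_defect_comm[of "D w" Z x]
        mul_comm[of Z x] mul_comm[of y])
  then show ?thesis
    by (simp add: * mul_comm[of y x])
qed

definition dual_mul :: "'a \<Rightarrow> 'a \<Rightarrow> 'a" where
  "dual_mul x y = x \<cdot> y \<cdot> Z"

lemma nabla_compatible:
  assumes lie_Z: "\<forall>x\<in>C. \<forall>y\<in>C. lie_defect Z x y = k \<cdot> (x \<cdot> y)" and [simp]: "k \<in> C"
    and a: "\<forall>y\<in>C. a y = E \<cdot> D y Z + v \<cdot> y" and [simp]: "v \<in> C"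
    and [simp]: "x \<in> C" "y \<in> C" "w \<in> C"
  defines "N \<equiv> \<lambda>x y z. nabla a x (dual_mul y z) - dual_mul (nabla a x y) z - dual_mul y (nabla a x z)"
  shows "N x y w = N y x w" and "N x y w = N x w y"
proof -
  have nabla_closed: "nabla a s t \<in> C" if "s \<in> C" "t \<in> C" for s t
    using that a by (simp add: nabla_def)
  show "N x y w = N x w y"
    using nabla_closed by (simp add: N_def dual_mul_def mul_comm)
  define u where "u = Z \<cdot> v"
  define z where "z = Z \<cdot> w"
  have [simp]: "u \<in> C" "z \<in> C" by (simp_all add: u_def z_def)
  have w: "w = E \<cdot> z" and v: "v = E \<cdot> u" by (simp_all add: u_def z_def)
  have nab: "nabla a s t = E \<cdot> (D s (Z \<cdot> t) + D t Z \<cdot> s + u \<cdot> t \<cdot> s)"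
    if [simp]: "s \<in> C" "t \<in> C" for s t
    using a by (simp add: nabla_def v distrib_left distrib_right mul_assoc add.assoc)
  have N: "N s t w = E \<cdot> (leibniz_defect (D s) (Z \<cdot> t) z + D (t \<cdot> z) Z \<cdot> s - D t Z \<cdot> s \<cdot> z
      - D w Z \<cdot> s \<cdot> (Z \<cdot> t) - u \<cdot> s \<cdot> t \<cdot> z)"
    if [simp]: "s \<in> C" "t \<in> C" for s t
  proof -
    have tw: "t \<cdot> w \<cdot> Z = t \<cdot> z"
      by (simp add: z_def mul_assoc mul_comm[of w])
    have "nabla a s (dual_mul t w) =
        E \<cdot> (D s (Z \<cdot> t \<cdot> z) + D (t \<cdot> z) Z \<cdot> s + u \<cdot> (t \<cdot> z) \<cdot> s)"
      by (simp add: dual_mul_def tw nab mul_assoc)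
    moreover have "dual_mul (nabla a s t) w =
        E \<cdot> ((D s (Z \<cdot> t) + D t Z \<cdot> s + u \<cdot> t \<cdot> s) \<cdot> z)"
      by (simp add: dual_mul_def nab z_def mul_assoc mul_comm[of w])
    moreover have "dual_mul t (nabla a s w) =
        E \<cdot> (Z \<cdot> t \<cdot> (D s z + D w Z \<cdot> s + u \<cdot> w \<cdot> s))"
    proof -
      have "dual_mul t (E \<cdot> r) = E \<cdot> (Z \<cdot> t \<cdot> r)" if "r \<in> C" for r
        using that by (simp add: dual_mul_def mul_ac)
      then show ?thesis by (simp add: nab z_def)
    qed
    moreover have "Z \<cdot> t \<cdot> (u \<cdot> w \<cdot> s) = u \<cdot> s \<cdot> t \<cdot> z"
      by (simp add: z_def mul_ac)
    moreover have "Z \<cdot> t \<cdot> (D w Z \<cdot> s) = D w Z \<cdot> s \<cdot> (Z \<cdot> t)"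
      by (simp add: mul_ac)
    moreover have "u \<cdot> (t \<cdot> z) \<cdot> s = u \<cdot> s \<cdot> t \<cdot> z" "u \<cdot> t \<cdot> s \<cdot> z = u \<cdot> s \<cdot> t \<cdot> z"
      by (simp_all add: mul_ac)
    ultimately show ?thesis
      by (simp add: N_def leibniz_defect_def distrib_left distrib_right
          diff_distrib_left algebra_simps)
  qed
  have "D w Z \<cdot> x \<cdot> (Z \<cdot> y) = D w Z \<cdot> y \<cdot> (Z \<cdot> x)" "u \<cdot> x \<cdot> y \<cdot> z = u \<cdot> y \<cdot> x \<cdot> z"
    by (simp_all add: mul_ac)
  then show "N x y w = N y x w"
    using compatibility_core_sym[OF lie_Z, of x y z] by (simp add: N)
qed

end


section \<open>The module of vector fields\<close>

lemma Ck_on_diff: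
  "Ck_on n k S f \<Longrightarrow> Ck_on n k S g \<Longrightarrow> Ck_on n k S (\<lambda>x. f x - g x)"
proof (induction k arbitrary: f g)
  case 0
  then show ?case by (simp add: continuous_map_diff)
next
  case (Suc k)
  obtain F where F: "\<forall>i<n. (\<forall>x\<in>S. ((\<lambda>t. f (x(i := t))) has_real_derivative F i x) (at (x i))) \<and>
      Ck_on n k S (F i)"
    using Suc.prems(1) by auto
  obtain G where G: "\<forall>i<n. (\<forall>x\<in>S. ((\<lambda>t. g (x(i := t))) has_real_derivative G i x) (at (x i))) \<and>
      Ck_on n k S (G i)"
    using Suc.prems(2) by auto
  have "\<forall>i<n. (\<forall>x\<in>S. ((\<lambda>t. f (x(i := t)) - g (x(i := t))) has_real_derivative
      F i x - G i x) (at (x i))) \<and> Ck_on n k S (\<lambda>x. F i x - G i x)"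
    using F G by (auto intro!: DERIV_diff Suc.IH)
  then show ?case
    using Suc.prems by (auto intro!: continuous_map_diff exI[of _ "\<lambda>i x. F i x - G i x"])
qed

lemma smooth_functions_diff:
  "f \<in> smooth_functions M \<Longrightarrow> g \<in> smooth_functions M \<Longrightarrow> (\<lambda>p. f p - g p) \<in> smooth_functions M"
  unfolding smooth_functions_def Cinf_on_def by (fastforce intro: Ck_on_diff)

lemma tangent_space_diff:
  "v \<in> tangent_space M p \<Longrightarrow> w \<in> tangent_space M p \<Longrightarrow> v - w \<in> tangent_space M p"
  unfolding tangent_space_def by (simp add: algebra_simps)

lemma vector_fields_diff:
  "X \<in> vector_fields M \<Longrightarrow> Y \<in> vector_fields M \<Longrightarrow> X - Y \<in> vector_fields M"
  unfolding vector_fields_def by (auto simp: tangent_space_diff smooth_functions_diff)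

lemma vector_fieldD: "X \<in> vector_fields M \<Longrightarrow> p \<in> points M \<Longrightarrow> X p \<in> tangent_space M p"
  by (simp add: vector_fields_def)

lemma comm_mult_vector_fields:
  assumes m: "tangent_multiplication M m" and e: "unit_field M m e"
  shows "comm_mult (vector_fields M) (vmult M m) e"
proof
  fix X Y W assume X: "X \<in> vector_fields M" and Y: "Y \<in> vector_fields M"
  note D = vector_fieldD[OF X] vector_fieldD[OF Y]
  show "X - Y \<in> vector_fields M" using X Y by (rule vector_fields_diff)
  show "vmult M m X Y \<in> vector_fields M"
    using m X Y by (simp add: tangent_multiplication_def)
  show "vmult M m X Y = vmult M m Y X"
    using m D by (auto simp: tangent_multiplication_def vmult_def fun_eq_iff)
  assume W: "W \<in> vector_fields M"
  note D = D vector_fieldD[OF W]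
  show "vmult M m (vmult M m X Y) W = vmult M m X (vmult M m Y W)"
    using m D by (auto simp: tangent_multiplication_def vmult_def fun_eq_iff)
  have "m p (X p + Y p) (W p) = m p (X p) (W p) + m p (Y p) (W p)" if "p \<in> points M" for p
  proof -
    have "linear_on_tangent M p (\<lambda>u. m p u (W p))"
      using m D(3) that by (simp add: tangent_multiplication_def)
    then show ?thesis using D(1,2) that by (simp add: linear_on_tangent_def)
  qed
  then show "vmult M m (X + Y) W = vmult M m X W + vmult M m Y W"
    by (auto simp: vmult_def fun_eq_iff)
next
  show "e \<in> vector_fields M" using e by (simp add: unit_field_def)
next
  fix X assume "X \<in> vector_fields M"
  then show "vmult M m e X = X"
    using e by (auto simp: unit_field_def vmult_def vector_fields_def fun_eq_iff)
qed

lemma inverse_field_works: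
  assumes "comm_mult (vector_fields M) (vmult M m) e" and "invertible_field M m e E"
  shows "inverse_field M m e E \<in> vector_fields M"
    and "vmult M m E (inverse_field M m e E) = e"
proof -
  interpret comm_mult "vector_fields M" "vmult M m" e by fact
  have E: "E \<in> vector_fields M" using assms(2) by (simp add: invertible_field_def)
  obtain Z where Z: "Z \<in> vector_fields M \<and> vmult M m E Z = e"
    using assms(2) by (auto simp: invertible_field_def)
  have "Z' = Z" if "Z' \<in> vector_fields M \<and> vmult M m E Z' = e" for Z'
    using that Z E by (metis mul_assoc mul_comm mul_unit)
  with Z have "inverse_field M m e E \<in> vector_fields M \<and> vmult M m E (inverse_field M m e E) = e"
    unfolding inverse_field_def by (rule theI)
  then show "inverse_field M m e E \<in> vector_fields M" "vmult M m E (inverse_field M m e E) = e"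
    by auto
qed

lemma vmult_dual_mult:
  "vmult M (dual_mult M m e E) X Y = vmult M m (vmult M m X Y) (inverse_field M m e E)"
  by (auto simp: vmult_def dual_mult_def)

lemma F_manifold_lie_mult_unit:
  assumes F: "F_manifold M m e" and XY: "X \<in> vector_fields M" "Y \<in> vector_fields M"
    and closed: "lie_mult M m e X Y \<in> vector_fields M"
  shows "lie_mult M m e X Y = 0"
proof -
  interpret comm_mult "vector_fields M" "vmult M m" e
    using F by (simp add: F_manifold_def comm_mult_vector_fields)
  have "lie_mult M m (vmult M m e e) X Y =
      vmult M m e (lie_mult M m e X Y) + vmult M m e (lie_mult M m e X Y)"
    using F XY unit_closed unfolding F_manifold_def by blast
  then show ?thesis using closed by simp
qed

theorem theorem8:
  fixes M :: "'a manifold" and m :: "'a tmult" and e E :: "'a vfield"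
    and D :: "'a cov_deriv" and A :: "'a endo"
  assumes "F_manifold M m e"
    and "eventual_identity M m e E"
    and "connection M D"
    and "torsion_free M D"
    and "compatible M m D"
    and "endo_section M A"
  shows "torsion_free M (nabla_A M m e E D A) \<and>
         compatible M (dual_mult M m e E) (nabla_A M m e E D A)
         \<longleftrightarrow>
         (\<exists>V\<in>vector_fields M. \<forall>Y\<in>vector_fields M.
            app_endo M A Y = vmult M m E (D Y (inverse_field M m e E)) + vmult M m V Y)"
proof -
  define Z where "Z = inverse_field M m e E"
  define a where "a = app_endo M A"
  have alg: "comm_mult (vector_fields M) (vmult M m) e"
    using assms(1) by (simp add: F_manifold_def comm_mult_vector_fields)
  interpret alg: comm_mult "vector_fields M" "vmult M m" e by (fact alg)
  have inv: "invertible_field M m e E" and dual: "F_manifold M (dual_mult M m e E) E"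
    using assms(2) by (auto simp: eventual_identity_def)
  interpret compatible_connection "vector_fields M" "vmult M m" e E Z D
  proof
    show "E \<in> vector_fields M" using inv by (simp add: invertible_field_def)
    show "Z \<in> vector_fields M" "vmult M m E Z = e"
      using inverse_field_works[OF alg inv] by (simp_all add: Z_def)
    show "D X Y \<in> vector_fields M" if "X \<in> vector_fields M" "Y \<in> vector_fields M" for X Y
      using assms(3) that by (simp add: connection_def)
    show "alg.leibniz_defect (D X) Y W = alg.leibniz_defect (D Y) X W"
      if "X \<in> vector_fields M" "Y \<in> vector_fields M" "W \<in> vector_fields M" for X Y W
      using assms(5) that unfolding compatible_def nabla_mult_def alg.leibniz_defect_def by blast
  qed
  have a: "a Y \<in> vector_fields M" if "Y \<in> vector_fields M" for Y
    using assms(6) that by (simp add: a_def endo_section_def)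
  have bracket: "lie_bracket X Y = bracket X Y"
    if "X \<in> vector_fields M" "Y \<in> vector_fields M" for X Y
    using assms(4) that by (simp add: torsion_free_def bracket_def)
  have nabla_A: "nabla_A M m e E D A = nabla a"
    by (intro ext) (simp only: nabla_A_def nabla_def flip: Z_def a_def)
  have dual_vmult: "vmult M (dual_mult M m e E) = dual_mul"
    by (intro ext) (simp only: vmult_dual_mult dual_mul_def flip: Z_def)
  have torsion: "torsion_free M (nabla a) \<longleftrightarrow>
      (\<exists>V\<in>vector_fields M. \<forall>Y\<in>vector_fields M. a Y = vmult M m E (D Y Z) + vmult M m V Y)"
    using nabla_torsion_free_iff[OF a] by (simp add: torsion_free_def bracket)
  have lie_mult: "lie_mult M m X Y W = lie_defect X Y W"
    if "X \<in> vector_fields M" "Y \<in> vector_fields M" "W \<in> vector_fields M" for X Y W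
    using that by (simp add: lie_mult_def alg.leibniz_defect_def bracket)
  have "bracket E (vmult M m (vmult M m X Y) Z) =
      vmult M m (vmult M m (bracket E X) Y) Z + vmult M m (vmult M m X (bracket E Y)) Z"
    if "X \<in> vector_fields M" "Y \<in> vector_fields M" for X Y
    using F_manifold_lie_mult_unit[OF dual, of X Y] that
    by (simp add: lie_mult_def dual_vmult dual_mul_def bracket algebra_simps)
  then obtain k where k: "k \<in> vector_fields M"
      "\<forall>X\<in>vector_fields M. \<forall>Y\<in>vector_fields M. lie_defect E X Y = vmult M m k (vmult M m X Y)"
    using dual_derivation_defect[of "bracket E"] by auto
  have "lie_defect (vmult M m X Y) W T =
      vmult M m X (lie_defect Y W T) + vmult M m Y (lie_defect X W T)"
    if "X \<in> vector_fields M" "Y \<in> vector_fields M" "W \<in> vector_fields M" "T \<in> vector_fields M"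
    for X Y W T
    using assms(1) that by (simp add: F_manifold_def lie_mult)
  note lie_inverse = inverse_lie_defect[OF k(2,1) this]
  obtain l where l: "l \<in> vector_fields M"
      "\<forall>X\<in>vector_fields M. \<forall>Y\<in>vector_fields M. lie_defect Z X Y = vmult M m l (vmult M m X Y)"
  proof
    show "- vmult M m (vmult M m Z Z) k \<in> vector_fields M" using k(1) by simp
  qed (use lie_inverse in blast)
  have "compatible M (dual_mult M m e E) (nabla a)"
    if "V \<in> vector_fields M" "\<forall>Y\<in>vector_fields M. a Y = vmult M m E (D Y Z) + vmult M m V Y" for V
    unfolding compatible_def nabla_mult_def dual_vmult
    by (intro ballI conjI; rule nabla_compatible[OF l(2,1) that(2,1)]; assumption)
  then show ?thesis
    using torsion unfolding nabla_A a_def[symmetric] Z_def[symmetric] by blast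
qed

end
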